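(* Let $X$ be a non-locally convex quasi-Banach space and let $I=[0,1]$. Then there exists a continuous, Riemann-integrable function $f:I\to X$ whose integral function $t\mapsto\int_0^t f(u)\,du$, $t\in I$, fails to have a left derivative at $t=1$; that is, the limit $\lim_{s\to1^-}\frac{1}{1-s}\int_s^1 f(u)\,du$ does not exist in $X$.
   Context: Quasi-Banach spaces are real: $X$ is a real vector space with a complete quasi-norm $\|\cdot\|$ (i.e. $\|x\|>0$ for $x\ne0$, $\|\alpha x\|=|\alpha|\|x\|$, $\|x+y\|\le\kappa(\|x\|+\|y\|)$ for some constant $\kappa\ge1$), with the vector topology induced by the quasi-norm; $X$ is non-locally convex if this topology is not locally convex (equivalently, $X$ is not isomorphic to a Banach space). A function $f:[a,b]\to X$ is Riemann-integrable if its Riemann sums over tagged partitions converge in $X$ as the mesh of the partition tends to $0$; the limit is $\int_a^b f(u)\,du$. A function that is Riemann-integrable on $I$ is Riemann-integrable on each compact subinterval. *)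

theory Defs
  imports "HOL-Analysis.Analysis"
begin

definition quasi_norm :: "('a::real_vector \<Rightarrow> real) \<Rightarrow> bool" where
  "quasi_norm q \<longleftrightarrow>
     (\<forall>x. x \<noteq> 0 \<longrightarrow> q x > 0) \<and>
     (\<forall>\<alpha> x. q (\<alpha> *\<^sub>R x) = \<bar>\<alpha>\<bar> * q x) \<and>
     (\<exists>\<kappa>\<ge>1. \<forall>x y. q (x + y) \<le> \<kappa> * (q x + q y))"

text \<open>The sets \<open>{y. q (y - x) < e}\<close> are neighbourhoods of \<open>x\<close>, but need not be open,
  since a quasi-norm need not be continuous for its own topology.\<close>

definition qn_open :: "('a::real_vector \<Rightarrow> real) \<Rightarrow> 'a set \<Rightarrow> bool" where
  "qn_open q U \<longleftrightarrow> (\<forall>x\<in>U. \<exists>e>0. {y. q (y - x) < e} \<subseteq> U)"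

definition qn_topology :: "('a::real_vector \<Rightarrow> real) \<Rightarrow> 'a topology" where
  "qn_topology q = topology (qn_open q)"

lemma istopology_qn_open: "istopology (qn_open q)"
proof -
  have "qn_open q (S \<inter> T)" if S: "qn_open q S" and T: "qn_open q T" for S T
    unfolding qn_open_def
  proof
    fix x assume x: "x \<in> S \<inter> T"
    obtain d where d: "d > 0" "{y. q (y - x) < d} \<subseteq> S"
      using S x unfolding qn_open_def by blast
    obtain e where e: "e > 0" "{y. q (y - x) < e} \<subseteq> T"
      using T x unfolding qn_open_def by blast
    have "min d e > 0" "{y. q (y - x) < min d e} \<subseteq> S \<inter> T"
      using d e by auto
    then show "\<exists>e>0. {y. q (y - x) < e} \<subseteq> S \<inter> T" by blast
  qed
  moreover have "qn_open q (\<Union>\<K>)" if "\<forall>K\<in>\<K>. qn_open q K" for \<K>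
    using that unfolding qn_open_def by (meson Sup_upper UnionE subset_trans)
  ultimately show ?thesis unfolding istopology_def by blast
qed

lemma openin_qn_topology: "openin (qn_topology q) U \<longleftrightarrow> qn_open q U"
  by (simp add: qn_topology_def istopology_qn_open)

lemma topspace_qn_topology [simp]: "topspace (qn_topology q) = UNIV"
proof -
  have "openin (qn_topology q) UNIV"
    unfolding openin_qn_topology qn_open_def using zero_less_one by blast
  then show ?thesis using openin_subset by blast
qed

definition quasi_banach :: "('a::real_vector \<Rightarrow> real) \<Rightarrow> bool" where
  "quasi_banach q \<longleftrightarrow>
     quasi_norm q \<and>
     (\<forall>s :: nat \<Rightarrow> 'a.
        (\<forall>e>0. \<exists>N. \<forall>m\<ge>N. \<forall>n\<ge>N. q (s m - s n) < e) \<longrightarrow>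
        (\<exists>l. limitin (qn_topology q) s l sequentially))"

definition locally_convex :: "'a::real_vector topology \<Rightarrow> bool" where
  "locally_convex T \<longleftrightarrow> neighbourhood_base_at 0 convex T"

text \<open>A tagged division may contain degenerate intervals; these contribute nothing to the
  Riemann sum.\<close>

definition has_riemann_integral ::
    "'a::real_vector topology \<Rightarrow> (real \<Rightarrow> 'a) \<Rightarrow> 'a \<Rightarrow> real \<Rightarrow> real \<Rightarrow> bool" where
  "has_riemann_integral T f y a b \<longleftrightarrow>
     (\<forall>U. openin T U \<and> y \<in> U \<longrightarrow>
        (\<exists>\<delta>>0. \<forall>p. p tagged_division_of {a..b} \<and> (\<forall>(x, K)\<in>p. measure lborel K < \<delta>) \<longrightarrow>
           (\<Sum>(x, K)\<in>p. measure lborel K *\<^sub>R f x) \<in> U))"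

definition riemann_integrable ::
    "'a::real_vector topology \<Rightarrow> (real \<Rightarrow> 'a) \<Rightarrow> real \<Rightarrow> real \<Rightarrow> bool" where
  "riemann_integrable T f a b \<longleftrightarrow> (\<exists>y. has_riemann_integral T f y a b)"

definition riemann_integral ::
    "'a::real_vector topology \<Rightarrow> (real \<Rightarrow> 'a) \<Rightarrow> real \<Rightarrow> real \<Rightarrow> 'a" where
  "riemann_integral T f a b = (THE y. has_riemann_integral T f y a b)"

definition has_left_derivative ::
    "'a::real_vector topology \<Rightarrow> (real \<Rightarrow> 'a) \<Rightarrow> 'a \<Rightarrow> real \<Rightarrow> bool" where
  "has_left_derivative T F D t \<longleftrightarrow>
     limitin T (\<lambda>s. (1 / (s - t)) *\<^sub>R (F s - F t)) D (at_left t)"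

end

theory Submission
  imports Defs
begin

text \<open>
  Let \<open>\<kappa>\<close> be the modulus of concavity of the quasi-norm. Failure of local convexity means that convex
  combinations of unit vectors are unbounded. Rescaling by the supremum of the quasi-norm over the
  convex combinations of a suitable finite family, one finds, for any \<open>c, H > 0\<close>, vectors of
  quasi-norm at most \<open>c\<close> whose subconvex combinations have quasi-norm at most \<open>H\<close>, and one of them
  at least \<open>H / 2\<close>. On an interval \<open>J\<close>, let \<open>g\<close> run through these vectors along successive bumps, on
  subintervals whose lengths are proportional to the weights of the extremal combination. Then \<open>g\<close> is
  pointwise bounded by \<open>c\<close>, while its integral has size between \<open>\<bar>J\<bar> H / 3\<close> and a multiple of \<open>\<bar>J\<bar> H\<close>,
  and all Riemann sums of \<open>g\<close> are \<open>O(\<bar>J\<bar> H + c)\<close>.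

  Put such blocks on \<open>J\<^sub>k = [1 - r\<^sup>k, 1 - r\<^sup>k\<^sup>+\<^sup>1]\<close> with \<open>r = 1 / (4\<kappa>)\<close>, \<open>c\<^sub>k = (2\<kappa>)\<^sup>-\<^sup>k\<close> and
  \<open>H\<^sub>k = 2\<^sup>k\<close>. Both \<open>c\<^sub>k\<close> and \<open>\<bar>J\<^sub>k\<bar> H\<^sub>k\<close> are at most \<open>(2\<kappa>)\<^sup>-\<^sup>k\<close>, which beats the factors
  \<open>\<kappa>\<^sup>k\<close> of the iterated triangle inequality; so the sum of the blocks is continuous and
  Riemann-integrable by an M-test. Its averages over \<open>J\<^sub>k\<close> grow like \<open>2\<^sup>k\<close>, whereas existence of the
  limit at \<open>1\<close> would bound them.
\<close>

subsection \<open>Riemann sums\<close>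

text \<open>Encoding vanishing mesh as a filter makes a Riemann integral an ordinary limit, so the
  same convergence lemmas serve continuity and integration.\<close>

definition riemann_filter :: "real \<Rightarrow> real \<Rightarrow> (real \<times> real set) set filter" where
  "riemann_filter a b =
     (INF \<delta>\<in>{0<..}. principal {p. p tagged_division_of {a..b} \<and> (\<forall>(x, K)\<in>p. measure lborel K < \<delta>)})"

definition riemann_sum :: "(real \<Rightarrow> 'a::real_vector) \<Rightarrow> (real \<times> real set) set \<Rightarrow> 'a" where
  "riemann_sum f p = (\<Sum>(x, K)\<in>p. measure lborel K *\<^sub>R f x)"

lemma eventually_riemann_filter:
  "eventually P (riemann_filter a b) \<longleftrightarrow>
     (\<exists>\<delta>>0. \<forall>p. p tagged_division_of {a..b} \<and> (\<forall>(x, K)\<in>p. measure lborel K < \<delta>) \<longrightarrow> P p)"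
proof -
  let ?S = "\<lambda>\<delta>. {p. p tagged_division_of {a..b} \<and> (\<forall>(x, K)\<in>p. measure lborel K < \<delta>)}"
  have "eventually P (riemann_filter a b) \<longleftrightarrow> (\<exists>\<delta>\<in>{0<..}. eventually P (principal (?S \<delta>)))"
    unfolding riemann_filter_def
  proof (rule eventually_INF_base)
    fix d e :: real assume "d \<in> {0<..}" "e \<in> {0<..}"
    then show "\<exists>x\<in>{0<..}. principal (?S x) \<le> inf (principal (?S d)) (principal (?S e))"
      by (intro bexI[of _ "min d e"]) auto
  qed (auto intro: exI[of _ 1])
  then show ?thesis
    by (auto simp: eventually_principal)
qed

lemma eventually_riemann_filter_tagged:
  "\<forall>\<^sub>F p in riemann_filter a b. p tagged_division_of {a..b}"
  unfolding eventually_riemann_filter using zero_less_one by blast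

text \<open>Cousin's lemma for a gauge of constant radius yields divisions of arbitrarily small
  mesh. Limits of Riemann sums are therefore unique and inherit bounds.\<close>

lemma riemann_filter_neq_bot: "riemann_filter a b \<noteq> bot"
proof -
  have "\<not> eventually (\<lambda>_. False) (riemann_filter a b)"
    unfolding eventually_riemann_filter
  proof safe
    fix d :: real
    assume d: "0 < d"
      and no: "\<forall>p. p tagged_division_of {a..b} \<and> (\<forall>(x, K)\<in>p. measure lborel K < d) \<longrightarrow> False"
    have "gauge (\<lambda>x. ball x (d / 3))"
      using d by (intro gauge_ball) simp
    then obtain p where p: "p tagged_division_of {a..b}" "(\<lambda>x. ball x (d / 3)) fine p"
      by (rule fine_division_exists_real)
    have "measure lborel K < d" if K: "(x, K) \<in> p" for x K
    proof -
      obtain u v where uv: "K = {u..v}"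
        using tagged_division_ofD(4)[OF p(1) K] by (auto simp: box_real)
      have "K \<noteq> {}" using tagged_division_ofD(2)[OF p(1) K] by auto
      moreover have "K \<subseteq> ball x (d / 3)" using p(2) K by (auto simp: fine_def)
      ultimately have "u \<le> v" "u \<in> ball x (d / 3)" "v \<in> ball x (d / 3)"
        unfolding uv by auto
      then have "u \<le> v" "\<bar>x - u\<bar> * 3 < d" "\<bar>x - v\<bar> * 3 < d"
        by (auto simp: dist_real_def)
      then have "v - u < d" using d by (simp add: abs_if split: if_splits)
      then show ?thesis using \<open>u \<le> v\<close> by (simp add: uv)
    qed
    with p no show False by blast
  qed
  then show ?thesis by (metis eventually_bot)
qed

text \<open>Uniform continuity controls the oscillation of \<open>\<phi>\<close> on each member of a
  fine division. The limit is thus the library integral, whose additivity and values become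
  available for the bumps.\<close>

lemma tendsto_riemann_sum:
  fixes \<phi> :: "real \<Rightarrow> real"
  assumes "continuous_on UNIV \<phi>"
  shows "(riemann_sum \<phi> \<longlongrightarrow> integral {a..b} \<phi>) (riemann_filter a b)"
proof (rule tendstoI)
  fix e :: real assume e: "0 < e"
  \<comment> \<open>The summand \<open>1\<close> keeps the denominator positive when
    \<open>a = b\<close> and makes the final estimate strict.\<close>
  define c where "c = e / (\<bar>b - a\<bar> + 1)"
  have c: "0 < c" using e by (simp add: c_def)
  have "uniformly_continuous_on {a..b} \<phi>"
    using assms by (intro compact_uniformly_continuous continuous_on_subset[OF assms]) auto
  then obtain d where d: "0 < d" "\<And>x y. x \<in> {a..b} \<Longrightarrow> y \<in> {a..b} \<Longrightarrow> dist y x < d \<Longrightarrow> dist (\<phi> y) (\<phi> x) < c"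
    unfolding uniformly_continuous_on_def using c by metis
  show "\<forall>\<^sub>F p in riemann_filter a b. dist (riemann_sum \<phi> p) (integral {a..b} \<phi>) < e"
    unfolding eventually_riemann_filter
  proof (intro exI[of _ d] conjI allI impI d(1); elim conjE)
    fix p assume p: "p tagged_division_of {a..b}" and mesh: "\<forall>(x, K)\<in>p. measure lborel K < d"
    have int: "\<phi> integrable_on S" if "S = {u..v}" for S u v
      unfolding that by (intro integrable_continuous_real continuous_on_subset[OF assms]) auto
    have p': "p tagged_division_of cbox a b" using p by simp
    have "integral {a..b} \<phi> = (\<Sum>(x, K)\<in>p. integral K \<phi>)"
      using integral_combine_tagged_division_topdown[OF int[of _ a b] p'] by simp
    then have "riemann_sum \<phi> p - integral {a..b} \<phi> = (\<Sum>(x, K)\<in>p. measure lborel K * \<phi> x - integral K \<phi>)"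
      by (simp add: riemann_sum_def sum_subtractf case_prod_unfold)
    also have "\<bar>\<dots>\<bar> \<le> (\<Sum>(x, K)\<in>p. measure lborel K * c)"
    proof (rule order_trans[OF sum_abs sum_mono], clarify)
      fix x K assume K: "(x, K) \<in> p"
      obtain u v where uv: "K = {u..v}"
        using tagged_division_ofD(4)[OF p K] by (auto simp: box_real)
      have sub: "K \<subseteq> {a..b}" and x: "x \<in> K"
        using tagged_division_ofD(2,3)[OF p K] by auto
      have le: "u \<le> v" using x uv by simp
      have len: "v - u < d" using mesh K le by (auto simp: uv)
      have "norm (\<phi> t - \<phi> x) \<le> c" if t: "t \<in> cbox u v" for t
      proof -
        have "dist t x < d" using x t len by (simp add: uv dist_real_def abs_if)
        moreover have "x \<in> {a..b}" "t \<in> {a..b}" using sub x t by (auto simp: uv)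
        ultimately show ?thesis using d(2)[of x t] by (simp add: dist_norm)
      qed
      moreover have "((\<lambda>t. \<phi> t - \<phi> x) has_integral integral K \<phi> - measure lborel K * \<phi> x) (cbox u v)"
        using has_integral_diff[OF integrable_integral[OF int[OF refl]] has_integral_const_real[of "\<phi> x" u v]] le
        by (simp add: uv)
      ultimately have "norm (integral K \<phi> - measure lborel K * \<phi> x) \<le> c * measure lborel (cbox u v)"
        using c by (intro has_integral_bound) auto
      then show "\<bar>measure lborel K * \<phi> x - integral K \<phi>\<bar> \<le> measure lborel K * c"
        by (simp add: uv abs_minus_commute mult.commute)
    qed
    also have "\<dots> = measure lborel (cbox a b) * c"
      using additive_content_tagged_division[OF p'] by (simp add: case_prod_unfold flip: sum_distrib_right)
    also have "\<dots> \<le> \<bar>b - a\<bar> * c"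
      using c by (intro mult_right_mono) (auto simp: content_real_if)
    also have "\<dots> < e"
      using e by (simp add: c_def field_simps)
    finally show "dist (riemann_sum \<phi> p) (integral {a..b} \<phi>) < e"
      by (simp add: dist_real_def)
  qed
qed

section \<open>Parabolic bump functions\<close>

text \<open>For \<open>a < b\<close> the factor \<open>4 / (b - a)\<^sup>2\<close> gives the
  parabola the maximum \<open>1\<close> at the midpoint. For \<open>a = b\<close> division by zero
  makes the function vanish, which suits a vector of weight zero.\<close>

definition bump :: "real \<Rightarrow> real \<Rightarrow> real \<Rightarrow> real" where
  "bump a b t = max 0 (4 / (b - a)\<^sup>2 * ((t - a) * (b - t)))"

lemma bump_nonneg: "0 \<le> bump a b t"
  by (simp add: bump_def)

lemma bump_eq_0:
  assumes "a \<le> b" "t \<notin> {a<..<b}"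
  shows "bump a b t = 0"
proof -
  have "(t - a) * (b - t) \<le> 0"
    using assms by (auto simp: mult_le_0_iff)
  then have "4 / (b - a)\<^sup>2 * ((t - a) * (b - t)) \<le> 0"
    by (rule mult_nonneg_nonpos[rotated]) simp
  then show ?thesis by (simp add: bump_def)
qed

lemma bump_le_1: "bump a b t \<le> 1"
proof -
  have "4 * ((t - a) * (b - t)) \<le> (b - a)\<^sup>2"
    using zero_le_power2[of "(t - a) - (b - t)"] by (simp add: power2_eq_square algebra_simps)
  then show ?thesis by (auto simp: bump_def divide_le_eq_1)
qed

lemma continuous_on_bump: "continuous_on S (bump a b)"
  unfolding bump_def by (intro continuous_intros)

lemma has_integral_bump:
  assumes "a \<le> b" "{a..b} \<subseteq> S"
  shows "(bump a b has_integral 2 / 3 * (b - a)) S"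
proof (cases "a = b")
  case True
  have "bump a b = (\<lambda>_. 0)" using True by (auto simp: bump_def)
  then show ?thesis using True by simp
next
  case False
  then have ab: "a < b" using assms by simp
  define F where "F t = 4 / (b - a)\<^sup>2 * ((b - a) * (t - a)\<^sup>2 / 2 - (t - a) ^ 3 / 3)" for t
  have "((\<lambda>t. 4 / (b - a)\<^sup>2 * ((t - a) * (b - t))) has_integral F b - F a) {a..b}"
  proof (rule fundamental_theorem_of_calculus[OF assms(1)])
    fix t assume "t \<in> {a..b}"
    have "(F has_real_derivative 4 / (b - a)\<^sup>2 * ((b - a) * (2 * (t - a)) / 2 - 3 * (t - a)\<^sup>2 / 3)) (at t within {a..b})"
      unfolding F_def by (intro DERIV_cmult) (auto intro!: derivative_eq_intros)
    also have "(b - a) * (2 * (t - a)) / 2 - 3 * (t - a)\<^sup>2 / 3 = (t - a) * (b - t)"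
      by (simp add: power2_eq_square field_simps)
    finally show "(F has_vector_derivative 4 / (b - a)\<^sup>2 * ((t - a) * (b - t))) (at t within {a..b})"
      by (simp add: has_real_derivative_iff_has_vector_derivative)
  qed
  moreover have "F b - F a = 2 / 3 * (b - a)"
  proof -
    define h where "h = b - a"
    have "h \<noteq> 0" using ab by (simp add: h_def)
    then show ?thesis
      unfolding F_def h_def[symmetric] by (simp add: power2_eq_square power3_eq_cube field_simps)
  qed
  moreover have "4 / (b - a)\<^sup>2 * ((t - a) * (b - t)) = bump a b t" if "t \<in> {a..b}" for t
    using that by (simp add: bump_def)
  ultimately have "(bump a b has_integral 2 / 3 * (b - a)) {a..b}"
    by (metis (no_types, lifting) has_integral_eq)
  then show ?thesis
    by (rule has_integral_on_superset[OF _ bump_eq_0 assms(2)]) (use assms(1) in auto)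
qed

lemma integral_bump_eq_0:
  assumes "a \<le> b" "S \<inter> {a<..<b} = {}"
  shows "integral S (bump a b) = 0"
proof -
  have "integral S (bump a b) = integral S (\<lambda>_. 0)"
    using assms by (intro integral_cong bump_eq_0) auto
  then show ?thesis by simp
qed

lemma bump_integrable: "bump a b integrable_on {c..d}"
  by (intro integrable_continuous_real continuous_on_bump)

subsection \<open>Convergence in quasi-normed spaces\<close>

locale quasi_normed =
  fixes q :: "'a::real_vector \<Rightarrow> real" and \<kappa> :: real
  assumes one_le_kappa: "1 \<le> \<kappa>"
    and pos: "x \<noteq> 0 \<Longrightarrow> 0 < q x"
    and scale: "q (\<alpha> *\<^sub>R x) = \<bar>\<alpha>\<bar> * q x"
    and triangle: "q (x + y) \<le> \<kappa> * (q x + q y)"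
begin

lemma kappa_pos: "0 < \<kappa>"
  using one_le_kappa by simp

lemma zero [simp]: "q 0 = 0"
  using scale[of 0 0] by simp

lemma nonneg [simp]: "0 \<le> q x"
  by (cases "x = 0") (use pos[of x] in auto)

lemma eq_0_iff: "q x = 0 \<longleftrightarrow> x = 0"
  using pos[of x] by fastforce

lemma minus [simp]: "q (- x) = q x"
  using scale[of "-1" x] by simp

lemma commute: "q (x - y) = q (y - x)"
  using minus[of "x - y"] by simp

lemma triangle_diff: "q (x - z) \<le> \<kappa> * (q (x - y) + q (y - z))"
  using triangle[of "x - y" "y - z"] by simp

lemma triangle_le:
  assumes "q x \<le> A" "q y \<le> B"
  shows "q (x + y) \<le> \<kappa> * (A + B)"
  by (rule order_trans[OF triangle]) (use assms kappa_pos in auto)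

text \<open>Each further summand costs one triangle inequality, and the \<open>- 1\<close> absorbs
  its bound \<open>1\<close> in the induction. The constant may grow with \<open>n\<close>, as it
  only serves to show that a supremum is finite.\<close>

lemma sum_bounded:
  assumes "\<And>k. k < n \<Longrightarrow> q (z k) \<le> 1"
  shows "q (\<Sum>k<n. z k) \<le> (2 * \<kappa>) ^ n - 1"
  using assms
proof (induction n)
  case (Suc n)
  have "q (\<Sum>k<Suc n. z k) \<le> \<kappa> * (((2 * \<kappa>) ^ n - 1) + 1)"
    unfolding sum.lessThan_Suc by (rule triangle_le) (use Suc in auto)
  also have "\<dots> \<le> (2 * \<kappa>) ^ Suc n - 1"
    using one_le_power[of \<kappa> "Suc n"] one_le_power[of 2 n] one_le_kappa
      mult_mono[of 1 "(2::real) ^ n" 1 "\<kappa> ^ Suc n"]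
    by (simp add: algebra_simps power_mult_distrib)
  finally show ?case .
qed simp

text \<open>Once the first term is split off, the others satisfy the hypothesis with
  \<open>C / (2 * \<kappa>)\<close>, so inductively they sum to at most \<open>C\<close>; one
  triangle inequality then gives \<open>\<kappa> * (C + C)\<close>. The decay pays for the repeated
  factor \<open>\<kappa>\<close>, uniformly in \<open>n\<close>.\<close>

lemma sum_geometric_bound:
  assumes "\<And>k. q (z k) \<le> C / (2 * \<kappa>) ^ k"
  shows "q (\<Sum>k<n. z k) \<le> 2 * \<kappa> * C"
  using assms
proof (induction n arbitrary: z C)
  case 0
  have "0 \<le> C" using order_trans[OF nonneg 0[of 0]] by simp
  then show ?case using kappa_pos by simp
next
  case (Suc n)
  have "q (\<Sum>k<n. z (Suc k)) \<le> 2 * \<kappa> * (C / (2 * \<kappa>))"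
    by (rule Suc.IH) (use Suc.prems[of "Suc _"] in simp)
  then have "q (\<Sum>k<n. z (Suc k)) \<le> C"
    using kappa_pos by simp
  moreover have "q (z 0) \<le> C"
    using Suc.prems[of 0] by simp
  ultimately have "q (z 0 + (\<Sum>k<n. z (Suc k))) \<le> \<kappa> * (C + C)"
    by (intro triangle_le)
  then show ?case
    by (simp add: sum.lessThan_Suc_shift del: sum.lessThan_Suc)
qed

lemma sum_geometric_tail:
  assumes "\<And>k. q (z k) \<le> C / (2 * \<kappa>) ^ k" and "m \<le> n"
  shows "q ((\<Sum>k<n. z k) - (\<Sum>k<m. z k)) \<le> 2 * \<kappa> * C / 2 ^ m"
proof -
  have C: "0 \<le> C" using order_trans[OF nonneg assms(1)[of 0]] by simp
  have "(\<Sum>k<n. z k) - (\<Sum>k<m. z k) = (\<Sum>k=m..<n. z k)"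
    using sum.atLeastLessThan_concat[of 0 m n z] assms(2)
    by (simp add: lessThan_atLeast0 algebra_simps)
  also have "\<dots> = (\<Sum>k<n - m. z (k + m))"
    using sum.shift_bounds_nat_ivl[of z 0 m "n - m"] assms(2) by (simp add: lessThan_atLeast0)
  also have "q \<dots> \<le> 2 * \<kappa> * (C / (2 * \<kappa>) ^ m)"
    by (rule sum_geometric_bound) (use assms(1)[of "_ + m"] in \<open>simp add: power_add mult.commute\<close>)
  also have "\<dots> \<le> 2 * \<kappa> * (C / 2 ^ m)"
  proof -
    have "(2::real) ^ m \<le> (2 * \<kappa>) ^ m"
      using one_le_kappa by (intro power_mono) auto
    then show ?thesis
      using C kappa_pos by (intro mult_left_mono divide_left_mono) auto
  qed
  finally show ?thesis by simp
qed

text \<open>Phrased through a real limit so that the library's limit calculus applies;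
  \<open>limitin_iff\<close> shows that this is convergence in \<open>qn_topology q\<close>.\<close>

definition converges :: "('b \<Rightarrow> 'a) \<Rightarrow> 'a \<Rightarrow> 'b filter \<Rightarrow> bool" where
  "converges g l F \<longleftrightarrow> ((\<lambda>p. q (g p - l)) \<longlongrightarrow> 0) F"

lemma convergesD:
  assumes "converges g l F" "0 < e"
  shows "\<forall>\<^sub>F p in F. q (g p - l) < e"
  using order_tendstoD(2)[OF assms(1)[unfolded converges_def] assms(2)] .

lemma convergesI:
  assumes "\<And>e. 0 < e \<Longrightarrow> \<forall>\<^sub>F p in F. q (g p - l) < e"
  shows "converges g l F"
  unfolding converges_def by (rule order_tendstoI) (auto intro: assms always_eventually less_le_trans[OF _ nonneg])

lemma converges_const: "converges (\<lambda>_. l) l F"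
  by (simp add: converges_def)

lemma converges_add:
  assumes "converges g l F" "converges h m F"
  shows "converges (\<lambda>p. g p + h p) (l + m) F"
  unfolding converges_def
proof (rule tendsto_sandwich[OF _ _ tendsto_const])
  show "\<forall>\<^sub>F p in F. q (g p + h p - (l + m)) \<le> \<kappa> * (q (g p - l) + q (h p - m))"
    using triangle[of "g _ - l" "h _ - m"] by (simp add: algebra_simps)
  show "((\<lambda>p. \<kappa> * (q (g p - l) + q (h p - m))) \<longlongrightarrow> 0) F"
    using assms unfolding converges_def
    by (auto intro!: tendsto_mult_right_zero tendsto_add_zero)
qed simp

lemma converges_sum:
  assumes "\<And>i. i \<in> A \<Longrightarrow> converges (g i) (l i) F"
  shows "converges (\<lambda>p. \<Sum>i\<in>A. g i p) (\<Sum>i\<in>A. l i) F"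
  using assms by (induction A rule: infinite_finite_induct) (auto intro: converges_add converges_const)

lemma converges_scaleR:
  assumes "(\<phi> \<longlongrightarrow> c) F"
  shows "converges (\<lambda>p. \<phi> p *\<^sub>R v) (c *\<^sub>R v) F"
proof -
  have "((\<lambda>p. \<bar>\<phi> p - c\<bar> * q v) \<longlongrightarrow> 0) F"
    using assms by (auto intro!: tendsto_mult_left_zero simp: tendsto_rabs_zero_iff LIM_zero_iff)
  then show ?thesis
    by (simp add: converges_def scale flip: scaleR_diff_left)
qed

lemma converges_unique:
  assumes "F \<noteq> bot" "converges g l F" "converges g m F"
  shows "l = m"
proof -
  have "((\<lambda>p. \<kappa> * (q (g p - l) + q (g p - m))) \<longlongrightarrow> 0) F"
    using assms(2,3) unfolding converges_def
    by (auto intro!: tendsto_mult_right_zero tendsto_add_zero)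
  moreover have "q (l - m) \<le> \<kappa> * (q (g p - l) + q (g p - m))" for p
    using triangle_diff[of l m "g p"] by (simp add: commute)
  ultimately have "q (l - m) \<le> 0"
    using assms(1) by (intro tendsto_lowerbound) auto
  then have "q (l - m) = 0"
    using nonneg[of "l - m"] by linarith
  then show ?thesis
    by (simp add: eq_0_iff)
qed

text \<open>A quasi-norm may be discontinuous in its own topology, so a bound passes to the limit
  only up to the factor \<open>\<kappa>\<close> of a triangle inequality.\<close>

lemma converges_bound:
  assumes "F \<noteq> bot" "converges g l F" "\<forall>\<^sub>F p in F. q (g p) \<le> B"
  shows "q l \<le> \<kappa> * B"
proof (rule tendsto_lowerbound)
  show "((\<lambda>p. \<kappa> * (q (g p - l) + B)) \<longlongrightarrow> \<kappa> * B) F"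
    using tendsto_add[OF assms(2)[unfolded converges_def] tendsto_const[of B]]
    by (auto intro: tendsto_mult_left)
  show "\<forall>\<^sub>F p in F. q l \<le> \<kappa> * (q (g p - l) + B)"
    using assms(3)
  proof eventually_elim
    case (elim p)
    then show ?case
      using triangle_le[of "l - g p" "q (g p - l)" "g p" B] by (simp add: commute)
  qed
qed (use assms in auto)

text \<open>An M-test: the tails are small uniformly along \<open>F\<close>, so a fixed initial
  segment controls both \<open>h\<close> and \<open>Y\<close>, and finite sums converge termwise.
  The number of terms that make up \<open>h p\<close> may depend on \<open>p\<close>. Taking
  \<open>F\<close> to be \<open>at t\<close> gives continuity, and the Riemann filter gives
  integrability.\<close>

lemma converges_series:
  assumes lim: "\<And>k. converges (g k) (y k) F"
    and Y: "converges (\<lambda>n. \<Sum>k<n. y k) Y sequentially"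
    and bound: "\<forall>\<^sub>F p in F. \<forall>k. q (g k p) \<le> C / (2 * \<kappa>) ^ k"
    and sum: "\<forall>\<^sub>F p in F. \<forall>\<^sub>F n in sequentially. h p = (\<Sum>k<n. g k p)"
  shows "converges h Y F"
proof (rule convergesI)
  fix e :: real assume e: "0 < e"
  \<comment> \<open>Two nested triangle inequalities join the three errors into at most
    \<open>3 * \<kappa>\<^sup>2 * d\<close>, which is below \<open>e\<close>.\<close>
  define d where "d = e / (4 * \<kappa>\<^sup>2)"
  have d: "0 < d" using e kappa_pos by (simp add: d_def)
  have "(\<lambda>m. 2 * \<kappa> * C / 2 ^ m) \<longlonglongrightarrow> 0"
    by (rule LIMSEQ_divide_realpow_zero) simp
  then have "\<forall>\<^sub>F m in sequentially. 2 * \<kappa> * C / 2 ^ m < d"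
    using d by (rule order_tendstoD)
  with convergesD[OF Y d] have "\<forall>\<^sub>F m in sequentially. 2 * \<kappa> * C / 2 ^ m < d \<and> q ((\<Sum>k<m. y k) - Y) < d"
    by eventually_elim simp
  then obtain m where m: "2 * \<kappa> * C / 2 ^ m < d" "q ((\<Sum>k<m. y k) - Y) < d"
    unfolding eventually_sequentially by auto
  have "converges (\<lambda>p. \<Sum>k<m. g k p) (\<Sum>k<m. y k) F"
    by (intro converges_sum lim)
  from convergesD[OF this d] bound sum show "\<forall>\<^sub>F p in F. q (h p - Y) < e"
  proof eventually_elim
    case (elim p)
    from elim(3) obtain n where n: "m \<le> n" "h p = (\<Sum>k<n. g k p)"
      unfolding eventually_sequentially using nat_le_linear by blast
    have "q (h p - (\<Sum>k<m. g k p)) \<le> d"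
      unfolding n(2) using sum_geometric_tail[of "\<lambda>k. g k p" C m n] elim(2) m(1) n(1) by simp
    moreover have "q ((\<Sum>k<m. g k p) - Y) \<le> \<kappa> * (d + d)"
      using triangle_le[of "(\<Sum>k<m. g k p) - (\<Sum>k<m. y k)" d "(\<Sum>k<m. y k) - Y" d] elim(1) m(2)
      by simp
    ultimately have "q (h p - Y) \<le> \<kappa> * (d + \<kappa> * (d + d))"
      using triangle_le[of "h p - (\<Sum>k<m. g k p)" d "(\<Sum>k<m. g k p) - Y" "\<kappa> * (d + d)"] by simp
    also have "\<dots> \<le> \<kappa> * (\<kappa> * d + \<kappa> * (d + d))"
      using d one_le_kappa by (intro mult_left_mono add_right_mono) auto
    also have "\<dots> = 3 * \<kappa>\<^sup>2 * d"
      by (simp add: power2_eq_square algebra_simps)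
    also have "\<dots> < e"
      using e kappa_pos by (simp add: d_def)
    finally show ?case .
  qed
qed

section \<open>Comparison with the topology of the quasi-norm\<close>

text \<open>As balls need not be open, \<open>U\<close> consists of the points with some ball around
  them inside the given one. It is open because a point closer than
  \<open>d / (2 * \<kappa>)\<close> to \<open>z\<close> has its ball of that same radius inside the
  ball of radius \<open>d\<close> about \<open>z\<close>.\<close>

lemma exists_open_in_ball:
  assumes "0 < e"
  obtains U where "openin (qn_topology q) U" "x \<in> U" "U \<subseteq> {y. q (y - x) < e}"
proof
  let ?U = "{z. \<exists>d>0. {y. q (y - z) < d} \<subseteq> {y. q (y - x) < e}}"
  show "openin (qn_topology q) ?U"
    unfolding openin_qn_topology qn_open_def
  proof
    fix z assume "z \<in> ?U"
    then obtain d where d: "0 < d" "{y. q (y - z) < d} \<subseteq> {y. q (y - x) < e}"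
      by blast
    have "w \<in> ?U" if w: "q (w - z) < d / (2 * \<kappa>)" for w
    proof -
      have "q (y - z) < d" if y: "q (y - w) < d / (2 * \<kappa>)" for y
      proof -
        have "q (y - z) \<le> \<kappa> * (q (y - w) + q (w - z))" by (rule triangle_diff)
        also have "\<dots> < \<kappa> * (d / (2 * \<kappa>) + d / (2 * \<kappa>))"
          using y w kappa_pos by (intro mult_strict_left_mono add_strict_mono)
        also have "\<dots> = d" using kappa_pos by (simp add: field_simps)
        finally show ?thesis .
      qed
      then have "{y. q (y - w) < d / (2 * \<kappa>)} \<subseteq> {y. q (y - x) < e}"
        using d(2) by blast
      then show ?thesis
        using d(1) kappa_pos by (auto intro!: exI[of _ "d / (2 * \<kappa>)"])
    qed
    then show "\<exists>r>0. {y. q (y - z) < r} \<subseteq> ?U"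
      using d(1) kappa_pos by (intro exI[of _ "d / (2 * \<kappa>)"]) auto
  qed
  show "x \<in> ?U" using assms by blast
  show "?U \<subseteq> {y. q (y - x) < e}"
  proof
    fix z assume "z \<in> ?U"
    then obtain d where "0 < d" "{y. q (y - z) < d} \<subseteq> {y. q (y - x) < e}" by blast
    then show "z \<in> {y. q (y - x) < e}" by (simp add: subset_iff)
  qed
qed

lemma eventually_open_iff:
  "(\<forall>U. openin (qn_topology q) U \<and> l \<in> U \<longrightarrow> eventually (\<lambda>p. g p \<in> U) F) \<longleftrightarrow> converges g l F"
proof safe
  assume L: "\<forall>U. openin (qn_topology q) U \<and> l \<in> U \<longrightarrow> eventually (\<lambda>p. g p \<in> U) F"
  show "converges g l F"
  proof (rule convergesI)
    fix e :: real assume "0 < e"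
    then obtain U where U: "openin (qn_topology q) U" "l \<in> U" "U \<subseteq> {y. q (y - l) < e}"
      by (rule exists_open_in_ball)
    with L have "eventually (\<lambda>p. g p \<in> U) F" by blast
    then show "\<forall>\<^sub>F p in F. q (g p - l) < e"
      by eventually_elim (use U(3) in blast)
  qed
next
  fix U assume g: "converges g l F" and "openin (qn_topology q) U" "l \<in> U"
  then obtain e where e: "0 < e" "{y. q (y - l) < e} \<subseteq> U"
    unfolding openin_qn_topology qn_open_def by blast
  from convergesD[OF g e(1)] show "eventually (\<lambda>p. g p \<in> U) F"
    by eventually_elim (use e(2) in blast)
qed

lemma limitin_iff: "limitin (qn_topology q) g l F \<longleftrightarrow> converges g l F"
  unfolding limitin_def eventually_open_iff by simp

lemma has_riemann_integral_iff:
  "has_riemann_integral (qn_topology q) f y a b \<longleftrightarrow> converges (riemann_sum f) y (riemann_filter a b)"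
  unfolding has_riemann_integral_def eventually_riemann_filter[symmetric] riemann_sum_def[symmetric]
  by (rule eventually_open_iff)

subsection \<open>Blocks of bumps\<close>

text \<open>If the convex hull of the unit ball were bounded, its multiples would be arbitrarily
  small convex neighbourhoods of \<open>0\<close>, and the topology would be locally convex.\<close>

lemma large_convex_combination:
  assumes "\<not> locally_convex (qn_topology q)"
  obtains u n x where "\<And>i. 0 \<le> u i" "(\<Sum>i<n. u i) = 1"
    "\<And>i. i < n \<Longrightarrow> q (x i) \<le> 1" "M < q (\<Sum>i<n::nat. u i *\<^sub>R x i)"
proof -
  have "\<exists>z \<in> convex hull {x. q x \<le> 1}. M < q z"
  proof (rule ccontr)
    assume "\<not> ?thesis"
    then have M: "q z \<le> M" if "z \<in> convex hull {x. q x \<le> 1}" for z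
      using that by force
    have M0: "0 \<le> M" using M[of 0] by (simp add: hull_inc)
    have "neighbourhood_base_at 0 convex (qn_topology q)"
      unfolding neighbourhood_base_at_def
    proof (intro allI impI)
      fix W assume "openin (qn_topology q) W \<and> 0 \<in> W"
      then obtain e where e: "0 < e" "{y. q (y - 0) < e} \<subseteq> W"
        unfolding openin_qn_topology qn_open_def by blast
      define r where "r = e / (M + 1)"
      have r: "0 < r" using e M0 by (simp add: r_def)
      obtain U where U: "openin (qn_topology q) U" "0 \<in> U" "U \<subseteq> {y. q (y - 0) < r}"
        using exists_open_in_ball[OF r] .
      let ?V = "(*\<^sub>R) r ` (convex hull {x. q x \<le> 1})"
      have "y \<in> ?V" if "q y < r" for y
      proof
        show "y = r *\<^sub>R ((1 / r) *\<^sub>R y)" using r by simp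
        show "(1 / r) *\<^sub>R y \<in> convex hull {x. q x \<le> 1}"
          using that r by (intro hull_inc) (simp add: scale)
      qed
      then have "U \<subseteq> ?V" using U(3) by auto
      moreover have "?V \<subseteq> W"
      proof clarify
        fix z assume z: "z \<in> convex hull {x. q x \<le> 1}"
        have "q (r *\<^sub>R z) \<le> r * M" using M[OF z] r by (simp add: scale)
        also have "\<dots> < e" using e M0 by (simp add: r_def field_simps)
        finally show "r *\<^sub>R z \<in> W" using e(2) by auto
      qed
      ultimately show "\<exists>U V. openin (qn_topology q) U \<and> convex V \<and> 0 \<in> U \<and> U \<subseteq> V \<and> V \<subseteq> W"
        using U(1,2) by (intro exI[of _ U] exI[of _ ?V]) (auto intro: convex_scaling)
    qed
    then show False using assms by (simp add: locally_convex_def)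
  qed
  then obtain k u x where *: "\<forall>i\<in>{1::nat..k}. 0 \<le> u i \<and> q (x i) \<le> 1" "sum u {1..k} = 1"
      "M < q (\<Sum>i=1..k. u i *\<^sub>R x i)"
    unfolding convex_hull_indexed by auto
  show thesis
  proof
    \<comment> \<open>The hull constrains the weights at indices \<open>1\<close> to
      \<open>k\<close> only; shifting and truncating at \<open>0\<close> makes them nonnegative at
      every index.\<close>
    show "0 \<le> max 0 (u (Suc i))" for i by simp
    have m: "max 0 (u (Suc i)) = u (Suc i)" if "i < k" for i using *(1) that by auto
    show "(\<Sum>i<k. max 0 (u (Suc i))) = 1"
      using *(2) by (simp add: sum.atLeast1_atMost_eq m)
    show "q (x (Suc i)) \<le> 1" if "i < k" for i using *(1) that by auto
    show "M < q (\<Sum>i<k. max 0 (u (Suc i)) *\<^sub>R x (Suc i))"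
      using *(3) by (simp add: sum.atLeast1_atMost_eq m)
  qed
qed

text \<open>For a suitable finite family in the unit ball, the supremum \<open>m\<close> of
  \<open>q\<close> over subconvex combinations is finite but exceeds \<open>H / c\<close>. Scaling
  the vectors by \<open>H / m\<close> turns the supremum into \<open>H\<close> and brings each
  vector below \<open>c\<close>.\<close>

lemma extremal_subconvex_combination:
  assumes "\<not> locally_convex (qn_topology q)" and c: "0 < c" and H: "0 < H"
  obtains u n x where "\<And>i. 0 \<le> u i" "(\<Sum>i<n. u i) \<le> 1"
    "\<And>i. i < n \<Longrightarrow> q (x i) \<le> c" "H / 2 \<le> q (\<Sum>i<n::nat. u i *\<^sub>R x i)"
    "\<And>w. (\<And>i. 0 \<le> w i) \<Longrightarrow> (\<Sum>i<n. w i) \<le> 1 \<Longrightarrow> q (\<Sum>i<n. w i *\<^sub>R x i) \<le> H"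
proof -
  obtain n v x where v: "\<And>i. 0 \<le> v i" "(\<Sum>i<n. v i) = 1"
    and x: "\<And>i. i < n \<Longrightarrow> q (x i) \<le> 1" and large: "H / c < q (\<Sum>i<n::nat. v i *\<^sub>R x i)"
    using large_convex_combination[OF assms(1), of "H / c"] by metis
  \<comment> \<open>Sums below \<open>1\<close> are allowed because the Riemann sums to be estimated
    may cover the interval of a block only partly.\<close>
  define W where "W = {w. (\<forall>i. 0 \<le> w i) \<and> (\<Sum>i<n. w i) \<le> (1::real)}"
  define S where "S = (\<lambda>w. q (\<Sum>i<n. w i *\<^sub>R x i)) ` W"
  have vS: "q (\<Sum>i<n. v i *\<^sub>R x i) \<in> S"
    unfolding S_def W_def by (rule imageI) (use v in simp)
  have bdd: "bdd_above S"
  proof (rule bdd_aboveI)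
    fix y assume "y \<in> S"
    then obtain w where w: "w \<in> W" "y = q (\<Sum>i<n. w i *\<^sub>R x i)"
      by (auto simp: S_def)
    have "q (w i *\<^sub>R x i) \<le> 1" if "i < n" for i
    proof -
      have "w i \<le> (\<Sum>i<n. w i)"
        using w(1) that by (intro member_le_sum) (auto simp: W_def)
      then have "w i \<le> 1" "0 \<le> w i" using w(1) by (auto simp: W_def)
      then show ?thesis using x[OF that] by (simp add: scale mult_le_one)
    qed
    then show "y \<le> (2 * \<kappa>) ^ n - 1"
      unfolding w(2) by (rule sum_bounded)
  qed
  define m where "m = Sup S"
  have mc: "H / c < m"
    using cSup_upper[OF vS bdd] large by (simp add: m_def)
  have "0 < H / c" using H c by simp
  \<comment> \<open>A combination above half the supremum exists and accounts for the
    \<open>H / 2\<close>.\<close>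
  then have m: "0 < m" "m / 2 < m" using mc by linarith+
  then obtain y where "y \<in> S" "m / 2 < y"
    using less_cSup_iff[OF _ bdd] vS unfolding m_def by blast
  then obtain u where u: "u \<in> W" "m / 2 < q (\<Sum>i<n. u i *\<^sub>R x i)"
    by (auto simp: S_def)
  have scaled: "q (\<Sum>i<n. w i *\<^sub>R ((H / m) *\<^sub>R x i)) = H / m * q (\<Sum>i<n. w i *\<^sub>R x i)" for w
  proof -
    have "(\<Sum>i<n. w i *\<^sub>R ((H / m) *\<^sub>R x i)) = (H / m) *\<^sub>R (\<Sum>i<n. w i *\<^sub>R x i)"
      by (simp add: scaleR_sum_right mult.commute)
    then show ?thesis using H m by (simp add: scale)
  qed
  show thesis
  proof
    show "0 \<le> u i" for i using u(1) by (simp add: W_def)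
    show "(\<Sum>i<n. u i) \<le> 1" using u(1) by (simp add: W_def)
    show "q ((H / m) *\<^sub>R x i) \<le> c" if "i < n" for i
    proof -
      have "q ((H / m) *\<^sub>R x i) \<le> H / m * 1"
        unfolding scale using x[OF that] H m by (intro mult_mono) auto
      also have "\<dots> \<le> c" using mc m c by (simp add: field_simps)
      finally show ?thesis .
    qed
    show "H / 2 \<le> q (\<Sum>i<n. u i *\<^sub>R ((H / m) *\<^sub>R x i))"
      unfolding scaled using mult_left_mono[OF less_imp_le[OF u(2)], of "H / m"] H m by simp
    show "q (\<Sum>i<n. w i *\<^sub>R ((H / m) *\<^sub>R x i)) \<le> H"
      if "\<And>i. 0 \<le> w i" "(\<Sum>i<n. w i) \<le> 1" for w
    proof -
      have "q (\<Sum>i<n. w i *\<^sub>R x i) \<le> m"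
        unfolding m_def by (rule cSup_upper[OF _ bdd]) (use that in \<open>auto simp: S_def W_def\<close>)
      then have "H / m * q (\<Sum>i<n. w i *\<^sub>R x i) \<le> H / m * m"
        using H m by (intro mult_left_mono) auto
      then show ?thesis unfolding scaled using m by simp
    qed
  qed
qed

section \<open>Riemann sums of a single block\<close>

text \<open>Distinct members have disjoint interiors, so \<open>D\<close> has at most one member,
  and its length is at most \<open>1\<close>.\<close>

lemma riemann_sum_straddling_bound:
  assumes p: "p tagged_division_of {a..b}" and "b - a \<le> 1"
    and D: "D \<subseteq> p" "\<And>x K. (x, K) \<in> D \<Longrightarrow> y \<in> interior K"
    and g: "\<And>t. q (g t) \<le> c"
  shows "q (riemann_sum g D) \<le> c"
proof (cases "D = {}")
  case True
  then show ?thesis using order_trans[OF nonneg g] by (simp add: riemann_sum_def)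
next
  case False
  then obtain x K where xK: "(x, K) \<in> D" by auto
  have "D = {(x, K)}"
  proof (rule ccontr)
    assume "D \<noteq> {(x, K)}"
    then obtain x' K' where x'K': "(x', K') \<in> D" "(x', K') \<noteq> (x, K)" using xK by auto
    then have "interior K' \<inter> interior K = {}"
      using tagged_division_ofD(5)[OF p] D(1) xK by blast
    then show False using D(2)[OF xK] D(2)[OF x'K'(1)] by blast
  qed
  then have *: "q (riemann_sum g D) = measure lborel K * q (g x)"
    by (simp add: riemann_sum_def scale)
  obtain u v where uv: "K = {u..v}"
    using tagged_division_ofD(4)[OF p] xK D(1) by (metis box_real(2) subsetD)
  have "x \<in> K" "K \<subseteq> {a..b}" using tagged_division_ofD(2,3)[OF p] xK D(1) by blast+
  then have "measure lborel K \<le> 1" using assms(2) by (auto simp: uv)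
  then show ?thesis
    unfolding * using g[of x] mult_mono[of "measure lborel K" 1 "q (g x)" c] by simp
qed

text \<open>The members inside \<open>{s..s'}\<close> have total length at most
  \<open>s' - s\<close>; divided by that number, their contribution is a subconvex combination,
  hence bounded by \<open>H\<close>. All other nonzero contributions come from at most two members,
  each bounded by \<open>c\<close>.\<close>

lemma riemann_sum_combination_bound:
  assumes p: "p tagged_division_of {a..b}" and ab: "b - a \<le> 1" and s: "s < s'"
    and g_def: "\<And>t. g t = (\<Sum>i<n::nat. \<phi> i t *\<^sub>R x i)"
    and \<phi>: "\<And>i t. 0 \<le> \<phi> i t" "\<And>t. (\<Sum>i<n. \<phi> i t) \<le> 1"
    and supp: "\<And>t. t \<notin> {s<..<s'} \<Longrightarrow> g t = 0"
    and c: "\<And>t. q (g t) \<le> c"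
    and H: "\<And>w. (\<And>i. 0 \<le> w i) \<Longrightarrow> (\<Sum>i<n. w i) \<le> 1 \<Longrightarrow> q (\<Sum>i<n. w i *\<^sub>R x i) \<le> H"
  shows "q (riemann_sum g p) \<le> \<kappa> * ((s' - s) * H + \<kappa> * (c + c))"
proof -
  \<comment> \<open>A member tagged inside the block but not contained in it has \<open>s\<close> or \<open>s'\<close> in its interior;
    there are at most two of these, however coarse the division is compared to \<open>s' - s\<close>.\<close>
  define A where "A = {(t, K) \<in> p. K \<subseteq> {s..s'}}"
  define B where "B = {(t, K) \<in> p - A. s \<in> interior K}"
  define E where "E = {(t, K) \<in> p - A - B. s' \<in> interior K}"
  have fin: "finite p" using p by auto
  have sub: "A \<subseteq> p" "B \<subseteq> p" "E \<subseteq> p" by (auto simp: A_def B_def E_def)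
  note fins = finite_subset[OF _ fin]
  have rest: "g t = 0" if tK: "(t, K) \<in> p - (A \<union> (B \<union> E))" for t K
  proof (rule supp, rule notI)
    assume t: "t \<in> {s<..<s'}"
    obtain u v where uv: "K = {u..v}"
      using tagged_division_ofD(4)[OF p] tK by (metis DiffD1 box_real(2))
    have "t \<in> K" using tagged_division_ofD(2)[OF p] tK by blast
    then have "K \<subseteq> {s..s'} \<or> s \<in> interior K \<or> s' \<in> interior K"
      using t by (auto simp: uv)
    then show False using tK by (auto simp: A_def B_def E_def)
  qed
  have "riemann_sum g p = riemann_sum g (A \<union> (B \<union> E))"
    unfolding riemann_sum_def
  proof (rule sum.mono_neutral_right[OF fin])
    show "A \<union> (B \<union> E) \<subseteq> p" using sub by blast
    show "\<forall>z\<in>p - (A \<union> (B \<union> E)). (case z of (t, K) \<Rightarrow> measure lborel K *\<^sub>R g t) = 0"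
    proof
      fix z assume "z \<in> p - (A \<union> (B \<union> E))"
      then show "(case z of (t, K) \<Rightarrow> measure lborel K *\<^sub>R g t) = 0"
        by (cases z) (simp add: rest del: Diff_iff)
    qed
  qed
  also have "\<dots> = riemann_sum g A + (riemann_sum g B + riemann_sum g E)"
    unfolding riemann_sum_def
    using sub fins by (subst sum.union_disjoint; (subst sum.union_disjoint)?) (auto simp: B_def E_def)
  finally have split: "riemann_sum g p = riemann_sum g A + (riemann_sum g B + riemann_sum g E)" .
  have "q (riemann_sum g A) \<le> (s' - s) * H"
  proof -
    define w where "w i = riemann_sum (\<phi> i) A / (s' - s)" for i
    have "riemann_sum g A = (\<Sum>i<n. riemann_sum (\<phi> i) A *\<^sub>R x i)"
      by (simp add: riemann_sum_def g_def case_prod_unfold scaleR_sum_right scaleR_sum_left sum.swap[of _ A])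
    also have "\<dots> = (s' - s) *\<^sub>R (\<Sum>i<n. w i *\<^sub>R x i)"
      using s by (simp add: w_def scaleR_sum_right)
    finally have eq: "riemann_sum g A = (s' - s) *\<^sub>R (\<Sum>i<n. w i *\<^sub>R x i)" .
    have "0 \<le> w i" for i
      using s \<phi>(1) unfolding w_def riemann_sum_def
      by (intro divide_nonneg_nonneg sum_nonneg) auto
    moreover have "(\<Sum>i<n. w i) \<le> 1"
    proof -
      have "(\<Sum>i<n. riemann_sum (\<phi> i) A) = (\<Sum>(t, K)\<in>A. measure lborel K * (\<Sum>i<n. \<phi> i t))"
        by (simp add: riemann_sum_def case_prod_unfold sum_distrib_left sum.swap[of _ A])
      also have "\<dots> \<le> (\<Sum>(t, K)\<in>A. measure lborel K)"
        using \<phi>(2) by (intro sum_mono) (auto intro: mult_left_le)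
      also have "\<dots> = sum (measure lborel) (snd ` A)"
      proof -
        have "A tagged_division_of \<Union>(snd ` A)"
          using tagged_partial_division_of_Union_self[OF
            tagged_partial_division_subset[OF tagged_division_of_def[THEN iffD1, OF p, THEN conjunct1] sub(1)]] .
        then show ?thesis
          by (rule sum.over_tagged_division_lemma) (simp add: box_eq_empty content_eq_0_interior)
      qed
      also have "\<dots> \<le> measure lborel (cbox s s')"
        by (rule subadditive_content_division[OF partial_division_of_tagged_division[OF
            tagged_partial_division_subset[OF tagged_division_of_def[THEN iffD1, OF p, THEN conjunct1] sub(1)]]])
          (auto simp: A_def)
      also have "\<dots> = s' - s" using s by simp
      finally show ?thesis using s by (simp add: w_def flip: sum_divide_distrib)
    qed
    ultimately have "q (\<Sum>i<n. w i *\<^sub>R x i) \<le> H" by (rule H)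
    then show ?thesis using s by (simp add: eq scale)
  qed
  moreover have "q (riemann_sum g B) \<le> c"
    by (rule riemann_sum_straddling_bound[OF p ab sub(2) _ c, where y = s]) (auto simp: B_def)
  moreover have "q (riemann_sum g E) \<le> c"
    by (rule riemann_sum_straddling_bound[OF p ab sub(3) _ c, where y = s']) (auto simp: E_def)
  ultimately show ?thesis
    unfolding split by (intro triangle_le)
qed

end

text \<open>Here \<open>Y a b\<close> is the Riemann integral of \<open>g\<close> over \<open>{a..b}\<close>. The bound on the Riemann sums
  does not require the mesh to be small.\<close>

locale block = quasi_normed +
  fixes s s' c H :: real and g :: "real \<Rightarrow> 'a" and Y :: "real \<Rightarrow> real \<Rightarrow> 'a"
  assumes supp: "t \<notin> {s<..<s'} \<Longrightarrow> g t = 0"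
    and bound: "q (g t) \<le> c"
    and cont: "converges g (g t) (at t)"
    and riemann_sum_bound: "p tagged_division_of {a..b} \<Longrightarrow> b - a \<le> 1 \<Longrightarrow>
      q (riemann_sum g p) \<le> \<kappa> * ((s' - s) * H + \<kappa> * (c + c))"
    and integral: "converges (riemann_sum g) (Y a b) (riemann_filter a b)"
    and integral_add: "a \<le> b \<Longrightarrow> b \<le> d \<Longrightarrow> Y a d = Y a b + Y b d"
    and integral_eq_0: "{a..b} \<inter> {s<..<s'} = {} \<Longrightarrow> Y a b = 0"
    and integral_large: "(s' - s) * H / 3 \<le> q (Y s s')"

context quasi_normed
begin

text \<open>The bumps have disjoint supports, so \<open>g t\<close> is a multiple of at most one
  \<open>x i\<close>, with factor at most \<open>1\<close>; this keeps it below \<open>c\<close>.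
  Integration adds all bumps up, and widths proportional to \<open>u i\<close> recover the extremal
  combination.\<close>

lemma exists_block:
  assumes nlc: "\<not> locally_convex (qn_topology q)" and c: "0 < c" and "0 < H" and s: "s < s'"
  shows "\<exists>g Y. block q \<kappa> s s' c H g Y"
proof (rule extremal_subconvex_combination[OF nlc c \<open>0 < H\<close>])
  fix u :: "nat \<Rightarrow> real" and n and x :: "nat \<Rightarrow> 'a"
  assume u: "\<And>i. 0 \<le> u i" "(\<Sum>i<n. u i) \<le> 1"
    and x: "\<And>i. i < n \<Longrightarrow> q (x i) \<le> c" and large: "H / 2 \<le> q (\<Sum>i<n. u i *\<^sub>R x i)"
    and H: "\<And>w. (\<And>i. 0 \<le> w i) \<Longrightarrow> (\<Sum>i<n. w i) \<le> 1 \<Longrightarrow> q (\<Sum>i<n. w i *\<^sub>R x i) \<le> H"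
  \<comment> \<open>Bump \<open>i\<close> gets width \<open>(s' - s) * u i\<close>; what lies
    between \<open>cut n\<close> and \<open>s'\<close> stays empty.\<close>
  define cut where "cut i = s + (s' - s) * (\<Sum>j<i. u j)" for i
  define \<phi> where "\<phi> i = bump (cut i) (cut (Suc i))" for i
  define g where "g t = (\<Sum>i<n. \<phi> i t *\<^sub>R x i)" for t
  define Y where "Y a b = (\<Sum>i<n. integral {a..b} (\<phi> i) *\<^sub>R x i)" for a b
  have cut_diff: "cut (Suc i) - cut i = (s' - s) * u i" for i
    by (simp add: cut_def algebra_simps)
  have "cut i \<le> cut (Suc i)" for i
  proof -
    have "0 \<le> (s' - s) * u i" using u(1) s by simp
    then show ?thesis using cut_diff[of i] by linarith
  qed
  then have mono: "cut i \<le> cut j" if "i \<le> j" for i j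
    using that by (rule lift_Suc_mono_le)
  have cut_0: "cut 0 = s" by (simp add: cut_def)
  have cut_n: "cut n \<le> s'"
  proof -
    have "(s' - s) * (\<Sum>j<n. u j) \<le> (s' - s) * 1"
      using u(2) s by (intro mult_left_mono) auto
    then show ?thesis by (simp add: cut_def)
  qed
  have range: "s \<le> cut i" "cut (Suc i) \<le> s'" if "i < n" for i
    using mono[of 0 i] mono[of "Suc i" n] that cut_0 cut_n by auto
  have \<phi>_0: "\<phi> i t = 0" if "t \<notin> {cut i<..<cut (Suc i)}" for i t
    unfolding \<phi>_def using mono[of i "Suc i"] that by (intro bump_eq_0) auto
  have single: "\<exists>i. \<forall>j. j \<noteq> i \<longrightarrow> \<phi> j t = 0" for t
  proof (cases "\<exists>i. \<phi> i t \<noteq> 0")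
    case True
    then obtain i where i: "cut i < t" "t < cut (Suc i)" using \<phi>_0 by force
    have "\<phi> j t = 0" if "j \<noteq> i" for j
      using that i mono[of "Suc j" i] mono[of "Suc i" j] \<phi>_0[of t j]
      by (cases "j < i") auto
    then show ?thesis by blast
  qed blast
  \<comment> \<open>The type of \<open>z\<close> is general because both the reals, for
    \<open>\<phi>_sum\<close>, and the vectors \<open>x\<close>, for \<open>g\<close>, are
    used.\<close>
  have sum_eq: "\<exists>i. (\<Sum>j<n. \<phi> j t *\<^sub>R z j) = (if i < n then \<phi> i t *\<^sub>R z i else 0)"
    for t and z :: "nat \<Rightarrow> 'b::real_vector"
  proof -
    obtain i where i: "\<And>j. j \<noteq> i \<Longrightarrow> \<phi> j t = 0" using single by blast
    have "(\<Sum>j<n. \<phi> j t *\<^sub>R z j) = (\<Sum>j<n. if j = i then \<phi> i t *\<^sub>R z i else 0)"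
      by (intro sum.cong) (auto simp: i)
    then show ?thesis by (auto simp: sum.delta)
  qed
  have \<phi>: "0 \<le> \<phi> i t" "\<phi> i t \<le> 1" for i t
    by (simp_all add: \<phi>_def bump_nonneg bump_le_1)
  have \<phi>_sum: "(\<Sum>i<n. \<phi> i t) \<le> 1" for t
  proof -
    obtain i where "(\<Sum>j<n. \<phi> j t *\<^sub>R (1::real)) = (if i < n then \<phi> i t *\<^sub>R 1 else 0)"
      using sum_eq[of t "\<lambda>_. 1"] by (rule exE)
    then show ?thesis using \<phi>(2)[of i t] by (simp split: if_splits)
  qed
  have supp: "g t = 0" if "t \<notin> {s<..<s'}" for t
  proof -
    have "\<phi> i t = 0" if "i < n" for i
      using range[OF that] \<open>t \<notin> {s<..<s'}\<close> by (intro \<phi>_0) auto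
    then show ?thesis by (simp add: g_def)
  qed
  have gc: "q (g t) \<le> c" for t
  proof -
    obtain i where i: "g t = (if i < n then \<phi> i t *\<^sub>R x i else 0)"
      unfolding g_def using sum_eq[of t x] by (rule exE)
    show ?thesis
    proof (cases "i < n")
      case True
      have "q (g t) \<le> 1 * c"
        using i True \<phi>[of i t] x[OF True] mult_mono[of "\<phi> i t" 1 "q (x i)" c] by (simp add: scale)
      then show ?thesis by simp
    qed (use i c in simp)
  qed
  have int: "\<phi> i integrable_on {a..b}" for i a b
    by (simp add: \<phi>_def bump_integrable)
  have "block q \<kappa> s s' c H g Y"
  proof
    show "converges g (g t) (at t)" for t
      unfolding g_def \<phi>_def
      by (intro converges_sum converges_scaleR continuous_on_tendsto_compose[OF continuous_on_bump[of UNIV]] tendsto_ident_at) auto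
    show "q (riemann_sum g p) \<le> \<kappa> * ((s' - s) * H + \<kappa> * (c + c))"
      if "p tagged_division_of {a..b}" "b - a \<le> 1" for p a b
      by (rule riemann_sum_combination_bound[OF that s g_def \<phi>(1) \<phi>_sum supp gc H])
    show "converges (riemann_sum g) (Y a b) (riemann_filter a b)" for a b
    proof -
      have "riemann_sum g p = (\<Sum>i<n. riemann_sum (\<phi> i) p *\<^sub>R x i)" for p
        by (simp add: riemann_sum_def g_def case_prod_unfold scaleR_sum_right scaleR_sum_left sum.swap[of _ p])
      moreover have "converges (\<lambda>p. \<Sum>i<n. riemann_sum (\<phi> i) p *\<^sub>R x i) (Y a b) (riemann_filter a b)"
        unfolding Y_def \<phi>_def
        by (intro converges_sum converges_scaleR tendsto_riemann_sum continuous_on_bump)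
      ultimately show ?thesis by (simp add: converges_def)
    qed
    show "Y a d = Y a b + Y b d" if "a \<le> b" "b \<le> d" for a b d
      unfolding Y_def
      by (simp add: Henstock_Kurzweil_Integration.integral_combine[OF that int, symmetric] scaleR_add_left sum.distrib)
    show "Y a b = 0" if "{a..b} \<inter> {s<..<s'} = {}" for a b
    proof -
      have "integral {a..b} (\<phi> i) = 0" if "i < n" for i
        unfolding \<phi>_def
      proof (rule integral_bump_eq_0)
        show "cut i \<le> cut (Suc i)" using mono by simp
        have "{cut i<..<cut (Suc i)} \<subseteq> {s<..<s'}" using range[OF that] by auto
        then show "{a..b} \<inter> {cut i<..<cut (Suc i)} = {}"
          using \<open>{a..b} \<inter> {s<..<s'} = {}\<close> by blast
      qed
      then show ?thesis by (simp add: Y_def)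
    qed
    have int_\<phi>: "integral {s..s'} (\<phi> i) = 2 / 3 * (s' - s) * u i" if "i < n" for i
      using has_integral_bump[of "cut i" "cut (Suc i)" "{s..s'}"] mono[of i "Suc i"] range[OF that]
      by (simp add: \<phi>_def cut_diff integral_unique mult.assoc)
    have "Y s s' = (2 / 3 * (s' - s)) *\<^sub>R (\<Sum>i<n. u i *\<^sub>R x i)"
      unfolding Y_def scaleR_sum_right
      by (intro sum.cong refl) (simp only: int_\<phi> lessThan_iff scaleR_scaleR)
    then have "q (Y s s') = 2 / 3 * (s' - s) * q (\<Sum>i<n. u i *\<^sub>R x i)"
      using s by (simp add: scale)
    \<comment> \<open>The mean \<open>2 / 3\<close> of a bump and the \<open>H / 2\<close> of the
      combination produce the \<open>H / 3\<close>.\<close>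
    moreover have "2 / 3 * (s' - s) * (H / 2) \<le> 2 / 3 * (s' - s) * q (\<Sum>i<n. u i *\<^sub>R x i)"
      using large s by (intro mult_left_mono) auto
    moreover have "2 / 3 * (s' - s) * (H / 2) = (s' - s) * H / 3" by simp
    ultimately show "(s' - s) * H / 3 \<le> q (Y s s')" by linarith
  qed (use supp gc in auto)
  then show ?thesis by blast
qed

end

subsection \<open>Superposition of blocks\<close>

locale complete_quasi_normed = quasi_normed +
  assumes complete: "(\<And>e. 0 < e \<Longrightarrow> \<exists>N. \<forall>m\<ge>N. \<forall>n\<ge>N. q (s m - s n) < e) \<Longrightarrow>
    \<exists>l. converges s l sequentially"
begin

lemma converges_geometric_series:
  assumes y: "\<And>k. q (y k) \<le> C / (2 * \<kappa>) ^ k"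
  shows "\<exists>Y. converges (\<lambda>n. \<Sum>k<n. y k) Y sequentially"
proof (rule complete)
  fix e :: real assume e: "0 < e"
  have "(\<lambda>m. 2 * \<kappa> * C / 2 ^ m) \<longlonglongrightarrow> 0"
    by (rule LIMSEQ_divide_realpow_zero) simp
  then have "\<forall>\<^sub>F m in sequentially. 2 * \<kappa> * C / 2 ^ m < e"
    using e by (rule order_tendstoD)
  then obtain N where N: "\<And>m. N \<le> m \<Longrightarrow> 2 * \<kappa> * C / 2 ^ m < e"
    unfolding eventually_sequentially by blast
  have *: "q ((\<Sum>k<n. y k) - (\<Sum>k<m. y k)) < e" if "N \<le> m" "m \<le> n" for m n
    using sum_geometric_tail[OF y that(2)] N[OF that(1)] by (rule le_less_trans)
  have "q ((\<Sum>k<m. y k) - (\<Sum>k<n. y k)) < e" if "N \<le> m" "N \<le> n" for m n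
  proof (cases "n \<le> m")
    case False
    then have "q ((\<Sum>k<n. y k) - (\<Sum>k<m. y k)) < e" using that by (intro *) auto
    then show ?thesis by (simp add: commute)
  qed (use that * in blast)
  then show "\<exists>N. \<forall>m\<ge>N. \<forall>n\<ge>N. q ((\<Sum>k<m. y k) - (\<Sum>k<n. y k)) < e"
    by blast
qed

lemma exists_oscillating_function:
  assumes nlc: "\<not> locally_convex (qn_topology q)"
  shows "\<exists>f I. (\<forall>t. converges f (f t) (at t)) \<and>
    (\<forall>a b. b - a \<le> 1 \<longrightarrow> converges (riemann_sum f) (I a b) (riemann_filter a b)) \<and>
    (\<forall>a b c. a \<le> b \<longrightarrow> b \<le> c \<longrightarrow> c - a \<le> 1 \<longrightarrow> I a c = I a b + I b c) \<and>
    (\<nexists>D. converges (\<lambda>s. (1 / (1 - s)) *\<^sub>R I s 1) D (at_left 1))"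
proof -
  \<comment> \<open>With \<open>2 * r = 1 / (2 * \<kappa>)\<close>, a block of length at most
    \<open>r ^ k\<close> and parameter \<open>2 ^ k\<close> contributes at most
    \<open>1 / (2 * \<kappa>) ^ k\<close>, the rate that the M-test requires.\<close>
  define r where "r = 1 / (4 * \<kappa>)"
  have r: "0 < r" "r \<le> 1 / 4" "2 * r = 1 / (2 * \<kappa>)"
    using one_le_kappa by (auto simp: r_def field_simps)
  define s where "s k = 1 - r ^ k" for k
  have rk: "0 < r ^ k" "r ^ k \<le> 1" for k
    using r by (auto intro: power_le_one)
  have s_diff: "s (Suc k) - s k = r ^ k * (1 - r)" for k
    by (simp add: s_def algebra_simps)
  have s_Suc: "s k < s (Suc k)" for k
  proof -
    have "0 < r ^ k * (1 - r)" using rk(1)[of k] r by (intro mult_pos_pos) auto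
    then show ?thesis using s_diff[of k] by linarith
  qed
  have s_mono: "s i \<le> s j" if "i \<le> j" for i j
    using less_imp_le[OF s_Suc] that by (rule lift_Suc_mono_le)
  have r_lim: "(\<lambda>k. r ^ k) \<longlonglongrightarrow> 0"
    using r by (intro LIMSEQ_realpow_zero) auto
  have s_lim: "s \<longlonglongrightarrow> 1"
    using tendsto_diff[OF tendsto_const[of 1] r_lim] by (simp add: s_def[abs_def])
  have "\<forall>k. \<exists>g Y. block q \<kappa> (s k) (s (Suc k)) (1 / (2 * \<kappa>) ^ k) (2 ^ k) g Y"
    using kappa_pos by (intro allI exists_block[OF nlc] s_Suc) auto
  then obtain G Y where blk: "\<And>k. block q \<kappa> (s k) (s (Suc k)) (1 / (2 * \<kappa>) ^ k) (2 ^ k) (G k) (Y k)"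
    by (auto simp: choice_iff)
  note supp = block.supp[OF blk] and G_bound = block.bound[OF blk] and G_cont = block.cont[OF blk]
    and Y_lim = block.integral[OF blk] and Y_add = block.integral_add[OF blk]
    and Y_0 = block.integral_eq_0[OF blk] and Y_large = block.integral_large[OF blk]
  define C where "C = \<kappa> * (1 + 2 * \<kappa>)"
  have R_bound: "q (riemann_sum (G k) p) \<le> C / (2 * \<kappa>) ^ k"
    if "p tagged_division_of {a..b}" "b - a \<le> 1" for k p a b
  proof -
    have "(s (Suc k) - s k) * 2 ^ k \<le> r ^ k * 2 ^ k"
      unfolding s_diff using rk[of k] r by (intro mult_right_mono) (auto simp: mult_le_cancel_left1)
    also have "\<dots> = (2 * r) ^ k" by (simp add: power_mult_distrib)
    also have "\<dots> = 1 / (2 * \<kappa>) ^ k" unfolding r(3) by (rule power_one_over)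
    finally have *: "(s (Suc k) - s k) * 2 ^ k \<le> 1 / (2 * \<kappa>) ^ k" .
    have "q (riemann_sum (G k) p) \<le>
        \<kappa> * ((s (Suc k) - s k) * 2 ^ k + \<kappa> * (1 / (2 * \<kappa>) ^ k + 1 / (2 * \<kappa>) ^ k))"
      using block.riemann_sum_bound[OF blk that] .
    also have "\<dots> \<le> \<kappa> * (1 / (2 * \<kappa>) ^ k + \<kappa> * (1 / (2 * \<kappa>) ^ k + 1 / (2 * \<kappa>) ^ k))"
      using kappa_pos * by (intro mult_left_mono add_right_mono) auto
    also have "\<dots> = C * (1 / (2 * \<kappa>) ^ k)"
      unfolding C_def by (simp only: distrib_left distrib_right mult_1 mult_2 mult.assoc)
    also have "\<dots> = C / (2 * \<kappa>) ^ k" by simp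
    finally show ?thesis .
  qed

  \<comment> \<open>The sum is finite at every \<open>t\<close>: a point left of \<open>1\<close>
    precedes all but finitely many blocks, and from \<open>1\<close> on all of them vanish.\<close>
  define f where "f t = (\<Sum>k | G k t \<noteq> 0. G k t)" for t
  have f_eq: "\<forall>\<^sub>F n in sequentially. f t = (\<Sum>k<n. G k t)" for t
  proof -
    have "\<exists>N. \<forall>k\<ge>N. G k t = 0"
    proof (cases "t < 1")
      case True
      then have "\<forall>\<^sub>F k in sequentially. t < s k"
        using s_lim by (simp add: order_tendstoD)
      then obtain N where "\<And>k. N \<le> k \<Longrightarrow> t < s k"
        unfolding eventually_sequentially by blast
      then have "G k t = 0" if "N \<le> k" for k
        using that by (intro supp) (auto dest: less_asym)
      then show ?thesis by blast
    next
      case False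
      have "s (Suc k) < 1" for k using rk(1)[of "Suc k"] by (simp add: s_def)
      then have "G k t = 0" for k
        using False by (intro supp) (auto intro: less_trans)
      then show ?thesis by blast
    qed
    then obtain N where N: "\<And>k. N \<le> k \<Longrightarrow> G k t = 0" by blast
    have "f t = (\<Sum>k<n. G k t)" if "N \<le> n" for n
      unfolding f_def
    proof (rule sum.mono_neutral_left)
      show "{k. G k t \<noteq> 0} \<subseteq> {..<n}"
      proof
        fix k assume "k \<in> {k. G k t \<noteq> 0}"
        then have "\<not> N \<le> k" using N by blast
        then show "k \<in> {..<n}" using that by simp
      qed
    qed auto
    then show ?thesis unfolding eventually_sequentially by blast
  qed
  \<comment> \<open>The M-test treats \<open>t = 1\<close>, where the blocks accumulate, like any
    other point.\<close>
  have f_cont: "converges f (f t) (at t)" for t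
  proof (rule converges_series[OF G_cont])
    have "\<forall>\<^sub>F n in sequentially. q ((\<Sum>k<n. G k t) - f t) = 0"
      using f_eq[of t] by eventually_elim simp
    then show "converges (\<lambda>n. \<Sum>k<n. G k t) (f t) sequentially"
      unfolding converges_def by (rule tendsto_eventually)
    show "\<forall>\<^sub>F u in at t. \<forall>k. q (G k u) \<le> 1 / (2 * \<kappa>) ^ k"
      by (intro always_eventually allI G_bound)
    show "\<forall>\<^sub>F u in at t. \<forall>\<^sub>F n in sequentially. f u = (\<Sum>k<n. G k u)"
      by (simp add: f_eq)
  qed

  \<comment> \<open>The bound on Riemann sums passes to the integrals \<open>Y k a b\<close> at the
    cost of a factor \<open>\<kappa>\<close>, which leaves the geometric rate intact.\<close>
  have I_ex: "\<exists>J. converges (\<lambda>n. \<Sum>k<n. Y k a b) J sequentially" if "b - a \<le> 1" for a b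
  proof (rule converges_geometric_series)
    fix k
    have "\<forall>\<^sub>F p in riemann_filter a b. q (riemann_sum (G k) p) \<le> C / (2 * \<kappa>) ^ k"
      using eventually_riemann_filter_tagged by eventually_elim (rule R_bound[OF _ that])
    then have "q (Y k a b) \<le> \<kappa> * (C / (2 * \<kappa>) ^ k)"
      by (rule converges_bound[OF riemann_filter_neq_bot Y_lim])
    then show "q (Y k a b) \<le> (\<kappa> * C) / (2 * \<kappa>) ^ k" by simp
  qed
  define I where "I a b = (SOME J. converges (\<lambda>n. \<Sum>k<n. Y k a b) J sequentially)" for a b
  have I: "converges (\<lambda>n. \<Sum>k<n. Y k a b) (I a b) sequentially" if "b - a \<le> 1" for a b
    unfolding I_def using I_ex[OF that] by (rule someI_ex)
  have f_int: "converges (riemann_sum f) (I a b) (riemann_filter a b)" if ab: "b - a \<le> 1" for a b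
  proof (rule converges_series[OF Y_lim I[OF ab]])
    show "\<forall>\<^sub>F p in riemann_filter a b. \<forall>k. q (riemann_sum (G k) p) \<le> C / (2 * \<kappa>) ^ k"
      using eventually_riemann_filter_tagged by eventually_elim (intro allI R_bound[OF _ ab])
    show "\<forall>\<^sub>F p in riemann_filter a b. \<forall>\<^sub>F n in sequentially. riemann_sum f p = (\<Sum>k<n. riemann_sum (G k) p)"
      using eventually_riemann_filter_tagged
    proof eventually_elim
      case (elim p)
      \<comment> \<open>A division has finitely many tags, so one \<open>n\<close> works for all of
        them.\<close>
      then have "\<forall>\<^sub>F n in sequentially. \<forall>z\<in>p. f (fst z) = (\<Sum>k<n. G k (fst z))"
        using f_eq by (intro eventually_ball_finite) auto
      then show ?case
      proof eventually_elim
        case (elim n)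
        have "riemann_sum f p = (\<Sum>z\<in>p. \<Sum>k<n. measure lborel (snd z) *\<^sub>R G k (fst z))"
          unfolding riemann_sum_def case_prod_unfold
          using elim by (intro sum.cong) (simp_all add: scaleR_sum_right)
        also have "\<dots> = (\<Sum>k<n. riemann_sum (G k) p)"
          by (simp add: riemann_sum_def case_prod_unfold sum.swap[of _ p])
        finally show ?case .
      qed
    qed
  qed
  have I_add: "I a c = I a b + I b c" if "a \<le> b" "b \<le> c" "c - a \<le> 1" for a b c
  proof (rule converges_unique[OF sequentially_bot I])
    have "(\<lambda>n. \<Sum>k<n. Y k a c) = (\<lambda>n. (\<Sum>k<n. Y k a b) + (\<Sum>k<n. Y k b c))"
      by (simp add: Y_add[OF that(1,2)] sum.distrib)
    then show "converges (\<lambda>n. \<Sum>k<n. Y k a c) (I a b + I b c) sequentially"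
      using converges_add[OF I[of b a] I[of c b]] that by simp
  qed (use that in simp)
  have I_block: "I (s k) (s (Suc k)) = Y k (s k) (s (Suc k))" for k
  proof (rule converges_unique[OF sequentially_bot I])
    \<comment> \<open>Block \<open>j\<close> ends by \<open>s k\<close> if \<open>j < k\<close> and
      starts no earlier than \<open>s (Suc k)\<close> if \<open>j > k\<close>.\<close>
    have "Y j (s k) (s (Suc k)) = 0" if "j \<noteq> k" for j
      using that s_mono[of "Suc j" k] s_mono[of "Suc k" j] by (intro Y_0) (cases "j < k", auto)
    then have "(\<Sum>j<n. Y j (s k) (s (Suc k))) = (\<Sum>j<n. if j = k then Y k (s k) (s (Suc k)) else 0)" for n
      by (intro sum.cong) auto
    then have Y_sum: "(\<Sum>j<n. Y j (s k) (s (Suc k))) = Y k (s k) (s (Suc k))" if "k < n" for n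
      using that by (simp add: sum.delta)
    have "\<forall>\<^sub>F n in sequentially. q ((\<Sum>j<n. Y j (s k) (s (Suc k))) - Y k (s k) (s (Suc k))) = 0"
      using eventually_gt_at_top[of k] by eventually_elim (simp add: Y_sum)
    then show "converges (\<lambda>n. \<Sum>j<n. Y j (s k) (s (Suc k))) (Y k (s k) (s (Suc k))) sequentially"
      unfolding converges_def by (rule tendsto_eventually)
  qed (use rk[of k] rk[of "Suc k"] in \<open>simp add: s_def\<close>)

  have "\<not> converges (\<lambda>s. (1 / (1 - s)) *\<^sub>R I s 1) D (at_left 1)" for D
  proof
    assume D: "converges (\<lambda>s. (1 / (1 - s)) *\<^sub>R I s 1) D (at_left 1)"
    \<comment> \<open>Eventually the averages at \<open>s k\<close> are within \<open>1\<close> of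
      \<open>D\<close>, hence bounded by \<open>B\<close>; since \<open>1 - s k = r ^ k\<close>, the
      integral from \<open>s k\<close> to \<open>1\<close> is at most
      \<open>B * r ^ k\<close>.\<close>
    define B where "B = \<kappa> * (1 + q D)"
    have B: "0 \<le> B" using kappa_pos by (simp add: B_def)
    have "filterlim s (at_left 1) sequentially"
      unfolding filterlim_at
    proof
      have "s k < 1" for k using rk(1)[of k] unfolding s_def by linarith
      then show "\<forall>\<^sub>F k in sequentially. s k \<in> {..<1} \<and> s k \<noteq> 1"
        by (simp add: less_imp_neq)
    qed (rule s_lim)
    with convergesD[OF D zero_less_one]
    have "\<forall>\<^sub>F k in sequentially. q ((1 / (1 - s k)) *\<^sub>R I (s k) 1 - D) < 1"
      unfolding filterlim_iff by blast
    then have avg: "\<forall>\<^sub>F k in sequentially. q (I (s k) 1) \<le> B * r ^ k"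
    proof eventually_elim
      case (elim k)
      have "q ((1 / (1 - s k)) *\<^sub>R I (s k) 1) \<le> B"
        using triangle_le[of "(1 / (1 - s k)) *\<^sub>R I (s k) 1 - D" 1 D "q D"] elim by (simp add: B_def)
      then show ?case
        using rk(1)[of k] by (simp add: s_def scale field_simps)
    qed
    \<comment> \<open>Subtracting the integrals from two consecutive points isolates one block,
      whose lower bound contains \<open>r ^ k * 2 ^ k\<close>. Cancelling \<open>r ^ k\<close>
      bounds \<open>2 ^ k\<close>; the \<open>8\<close> is \<open>6\<close> divided by the lower
      bound \<open>3 / 4\<close> of \<open>1 - r\<close>.\<close>
    have "\<forall>\<^sub>F k in sequentially. 2 ^ k \<le> 8 * \<kappa> * B"
      using avg avg[THEN eventually_sequentially_Suc[THEN iffD2]]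
    proof eventually_elim
      case (elim k)
      have "I (s k) 1 = I (s k) (s (Suc k)) + I (s (Suc k)) 1"
        using less_imp_le[OF s_Suc[of k]] rk[of k] rk[of "Suc k"]
        by (intro I_add) (auto simp: s_def)
      then have "q (Y k (s k) (s (Suc k))) = q (I (s k) 1 + - I (s (Suc k)) 1)"
        by (simp add: I_block)
      also have "\<dots> \<le> \<kappa> * (B * r ^ k + B * r ^ Suc k)"
        using elim by (intro triangle_le) auto
      also have "\<dots> \<le> \<kappa> * (B * r ^ k + B * r ^ k)"
        using kappa_pos B rk[of k] r
        by (intro mult_left_mono add_left_mono) (auto simp: mult_left_le_one_le)
      finally have "r ^ k * (1 - r) * 2 ^ k / 3 \<le> 2 * \<kappa> * B * r ^ k"
        using Y_large[of k] unfolding s_diff by simp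
      then have "r ^ k * ((1 - r) * 2 ^ k) \<le> r ^ k * (6 * \<kappa> * B)"
        by (simp add: algebra_simps)
      then have "(1 - r) * 2 ^ k \<le> 6 * \<kappa> * B"
        using rk(1)[of k] by simp
      moreover have "3 / 4 * 2 ^ k \<le> (1 - r) * 2 ^ k"
        using r by (intro mult_right_mono) auto
      ultimately show ?case by linarith
    qed
    moreover have "\<forall>\<^sub>F k in sequentially. 8 * \<kappa> * B < 2 ^ k"
      using filterlim_real_sequentially[THEN filterlim_at_top_dense[THEN iffD1], rule_format, of "8 * \<kappa> * B"]
      by eventually_elim (use of_nat_less_two_power less_trans in blast)
    ultimately have "\<forall>\<^sub>F k::nat in sequentially. False"
      by eventually_elim simp
    then show False by simp
  qed
  then show ?thesis
    using f_cont f_int I_add by blast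
qed

end

section \<open>Return to the topological formulation\<close>

lemma quasi_banach_complete_quasi_normed:
  assumes "quasi_banach q"
  obtains \<kappa> where "complete_quasi_normed q \<kappa>"
proof -
  from assms obtain \<kappa> where \<kappa>: "quasi_normed q \<kappa>"
    unfolding quasi_banach_def quasi_norm_def quasi_normed_def by blast
  then interpret quasi_normed q \<kappa> .
  have "complete_quasi_normed q \<kappa>"
    using assms unfolding quasi_banach_def limitin_iff by unfold_locales blast
  then show thesis by (rule that)
qed

theorem mainTheorem4:
  fixes q :: "'a::real_vector \<Rightarrow> real"
  assumes "quasi_banach q"
    and "\<not> locally_convex (qn_topology q)"
  shows "\<exists>f :: real \<Rightarrow> 'a.
      continuous_map (top_of_set {0..1}) (qn_topology q) f \<and>
      riemann_integrable (qn_topology q) f 0 1 \<and>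
      (\<nexists>D. has_left_derivative (qn_topology q)
              (\<lambda>t. riemann_integral (qn_topology q) f 0 t) D 1) \<and>
      (\<nexists>D. limitin (qn_topology q)
              (\<lambda>s. (1 / (1 - s)) *\<^sub>R riemann_integral (qn_topology q) f s 1) D (at_left 1))"
proof -
  obtain \<kappa> where "complete_quasi_normed q \<kappa>"
    using quasi_banach_complete_quasi_normed[OF assms(1)] .
  then interpret complete_quasi_normed q \<kappa> .
  obtain f I where cont: "\<And>t. converges f (f t) (at t)"
    and int: "\<And>a b. b - a \<le> 1 \<Longrightarrow> converges (riemann_sum f) (I a b) (riemann_filter a b)"
    and add: "\<And>a b c. a \<le> b \<Longrightarrow> b \<le> c \<Longrightarrow> c - a \<le> 1 \<Longrightarrow> I a c = I a b + I b c"
    and no_lim: "\<And>D. \<not> converges (\<lambda>s. (1 / (1 - s)) *\<^sub>R I s 1) D (at_left 1)"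
    using exists_oscillating_function[OF assms(2)] by blast
  have integral: "riemann_integral (qn_topology q) f a b = I a b" if "b - a \<le> 1" for a b
    unfolding riemann_integral_def has_riemann_integral_iff
    using int[OF that] converges_unique[OF riemann_filter_neq_bot] by blast
  \<comment> \<open>For \<open>0 < s < 1\<close> all intervals involved have length at most
    \<open>1\<close>, where \<open>I\<close> is known to be the Riemann integral.\<close>
  have near: "\<forall>\<^sub>F s in at_left 1. 0 < s \<and> s < (1::real)"
    unfolding eventually_at_left_field by (intro exI[of _ 0]) auto
  have cong: "converges h D (at_left 1) \<longleftrightarrow> converges (\<lambda>s. (1 / (1 - s)) *\<^sub>R I s 1) D (at_left 1)"
    if "\<And>s. 0 < s \<Longrightarrow> s < 1 \<Longrightarrow> h s = (1 / (1 - s)) *\<^sub>R I s 1" for h D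
    unfolding converges_def by (rule tendsto_cong, use near in eventually_elim) (simp add: that)
  show ?thesis
  proof (intro exI[of _ f] conjI notI; (elim exE)?)
    have "atin euclidean t = at t" for t :: real
      by (auto simp: filter_eq_iff eventually_atin eventually_at_topological)
    then have "continuous_map euclidean (qn_topology q) f"
      unfolding continuous_map_atin limitin_iff using cont by simp
    then show "continuous_map (top_of_set {0..1}) (qn_topology q) f"
      by (rule continuous_map_from_subtopology)
    show "riemann_integrable (qn_topology q) f 0 1"
      unfolding riemann_integrable_def has_riemann_integral_iff using int[of 1 0] by auto
    show False if "has_left_derivative (qn_topology q) (\<lambda>t. riemann_integral (qn_topology q) f 0 t) D 1" for D
    proof -
      \<comment> \<open>Numerator and denominator both change sign, so the difference quotient is
        the average over \<open>{s..1}\<close>.\<close>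
      have "(1 / (s - 1)) *\<^sub>R (riemann_integral (qn_topology q) f 0 s - riemann_integral (qn_topology q) f 0 1)
          = (1 / (1 - s)) *\<^sub>R I s 1" if "0 < s" "s < 1" for s
      proof -
        have "riemann_integral (qn_topology q) f 0 s - riemann_integral (qn_topology q) f 0 1 = - I s 1"
          using add[of 0 s 1] that by (simp add: integral)
        moreover have "1 / (s - 1) = - (1 / (1 - s))"
          using that by (simp add: field_simps)
        ultimately show ?thesis by simp
      qed
      from cong[OF this] show False
        using that no_lim unfolding has_left_derivative_def limitin_iff by blast
    qed
    show False if "limitin (qn_topology q)
        (\<lambda>s. (1 / (1 - s)) *\<^sub>R riemann_integral (qn_topology q) f s 1) D (at_left 1)" for D
      using that no_lim cong[of "\<lambda>s. (1 / (1 - s)) *\<^sub>R riemann_integral (qn_topology q) f s 1" D]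
      by (simp add: limitin_iff integral)
  qed
qed

end
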